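(* Consider the MAS-SALD with $n$ agents and local resources $a_1,\dots,a_n$, and let $C:=\sum_{i=1}^n a_i$ and $\lambda^\dag>0$ be given. Suppose each utility function is $f_i(x_i)=-\tfrac12 b_i x_i^2+k_i x_i$ with $b_i\in\mathbb{R}^{\ge 0}$ and $k_i\in\mathbb{R}^{\ge 0}$. Write $\mathbf{k}=(k_1,\dots,k_n)$ and $\mathbf{b}=(b_1,\dots,b_n)$. The following statements hold. (i) The competitive equilibrium is unique, and therefore there exists a well-defined mapping $\mathcal{F}(\cdot,\cdot)$ that maps $(\mathbf{k},\mathbf{b})$ to $\lambda^\ast:=\mathcal{F}(\mathbf{k},\mathbf{b})$, where $\lambda^\ast$ is the price belonging to the competitive equilibrium. (ii) The competitive equilibrium is always socially resilient (i.e. $\lambda^\ast\le\lambda^\dag$) for all socially admissible utility functions as long as $(k_{\min},k_{\max},b_{\min},b_{\max})\in\mathscr{S}_\ast$. (iii) Let $(k_{\min},k_{\max},b_{\min},b_{\max})\in\mathscr{S}_\ast$ be given. The mapping $\mathcal{F}(\cdot,\cdot)$ is monotone under the partial order $\preceq$ over $\mathbf{k}$, in the sense that $$\mathcal{F}(\mathbf{k},\mathbf{b})\le\mathcal{F}(\mathbf{k}',\mathbf{b})$$ for all socially admissible $\mathbf{k}\preceq\mathbf{k}'$.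
   Context: $\mathbb{R}^{\ge 0}=[0,\infty)$. Multi-agent system with static agent load decisions (MAS-SALD): there are $n$ agents; agent $i$ holds $a_i$ units of a local resource, chooses a load $x_i\in\mathbb{R}^{\ge 0}$ and has utility $f_i(x_i)$. Each unit of resource is priced at $\lambda\in\mathbb{R}$. Competitive equilibrium (MAS-SALD): a pair $(\lambda^\ast,\mathbf{x}^\ast)$ with $\lambda^\ast\in\mathbb{R}$, $\mathbf{x}^\ast=(x_1^\ast,\dots,x_n^\ast)^\top$, such that (a) for every $i$, $x_i^\ast$ is a maximizer of $f_i(x_i)+\lambda^\ast(a_i-x_i)$ over $x_i\in\mathbb{R}^{\ge 0}$; and (b) $\sum_{i=1}^n x_i^\ast=\sum_{i=1}^n a_i$. Given $k_{\min},k_{\max},b_{\min},b_{\max}$, a utility function $f_i(x_i)=-\tfrac12 b_i x_i^2+k_i x_i$ is called socially admissible if $k_i\in[k_{\min},k_{\max}]$ and $b_i\in[b_{\min},b_{\max}]$. The number $\lambda^\dag>0$ is the highest price that agents can accept. Partial order: for $\mathbf{l},\mathbf{l}'\in\mathbb{R}^n$, $\mathbf{l}\preceq\mathbf{l}'$ means $l_i\le l_i'$ for all $i=1,\dots,n$. The set $\mathscr{S}_\ast$ consists of all $(k_{\min},k_{\max},b_{\min},b_{\max})\in(\mathbb{R}^{\ge 0})^4$ satisfying $$\frac{n k_{\min}}{b_{\max}}\ge C,\qquad -\frac{n k_{\min}}{b_{\max}}+\frac{n k_{\max}}{b_{\min}}\le C,\qquad -\frac{n\lambda^\dag}{b_{\max}}+\frac{n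 k_{\max}}{b_{\min}}\le C.$$
   Formalization: C>0 is assumed (for C=0 prices are not unique, for C<0 no equilibrium exists); in (i), for b_i≥0 existence and uniqueness of the price are shown, and uniqueness of the loads only when all b_i>0 (it fails for ties with b_i=0); b_min, b_max in S_* are nonzero. *)

theory Defs
  imports "HOL-Analysis.Analysis"
begin

text \<open>Agents are the elements of a finite type \<open>'n\<close>, so the number of agents is \<open>CARD('n)\<close>.
  The componentwise order on vectors is the library's \<open>\<le>\<close> on \<^typ>\<open>real ^ 'n\<close>.\<close>

definition competitive_equilibria ::
    "real ^ 'n \<Rightarrow> ('n \<Rightarrow> real \<Rightarrow> real) \<Rightarrow> (real \<times> (real ^ 'n)) set" where
  "competitive_equilibria a f =
     {(lam, x). (\<forall>i. is_arg_max (\<lambda>y. f i y + lam * (a $ i - y)) (\<lambda>y. 0 \<le> y) (x $ i)) \<and>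
                (\<Sum>i\<in>UNIV. x $ i) = (\<Sum>i\<in>UNIV. a $ i)}"

definition quad_utility :: "real ^ 'n \<Rightarrow> real ^ 'n \<Rightarrow> 'n \<Rightarrow> real \<Rightarrow> real" where
  "quad_utility k b i y = - (1 / 2) * b $ i * y\<^sup>2 + k $ i * y"

text \<open>Meaningful only where the equilibrium exists and its price is unique.\<close>

definition equilibrium_price :: "real ^ 'n \<Rightarrow> real ^ 'n \<Rightarrow> real ^ 'n \<Rightarrow> real" where
  "equilibrium_price a k b =
     (THE lam. \<exists>x. (lam, x) \<in> competitive_equilibria a (quad_utility k b))"

text \<open>Admissibility of a profile of quadratic utilities, expressed through their coefficients
  (which the utility functions determine).\<close>

definition socially_admissible ::
    "real \<times> real \<times> real \<times> real \<Rightarrow> real ^ 'n \<Rightarrow> real ^ 'n \<Rightarrow> bool" where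
  "socially_admissible = (\<lambda>(kmin, kmax, bmin, bmax) k b.
     \<forall>i. k $ i \<in> {kmin..kmax} \<and> b $ i \<in> {bmin..bmax})"

text \<open>The bounds \<open>bmin\<close> and \<open>bmax\<close> occur as denominators and are therefore taken to be nonzero;
  with the convention \<open>x / 0 = 0\<close> the inequalities would otherwise be satisfied spuriously.\<close>

definition S_star :: "nat \<Rightarrow> real \<Rightarrow> real \<Rightarrow> (real \<times> real \<times> real \<times> real) set" where
  "S_star n C lam_dag =
     {(kmin, kmax, bmin, bmax).
        0 \<le> kmin \<and> 0 \<le> kmax \<and> 0 < bmin \<and> 0 < bmax \<and>
        real n * kmin / bmax \<ge> C \<and>
        - (real n * kmin / bmax) + real n * kmax / bmin \<le> C \<and>
        - (real n * lam_dag / bmax) + real n * kmax / bmin \<le> C}"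

end

theory Submission
  imports Defs
begin

text \<open>Each agent's problem is concave, so optimal loads are characterised by complementary slackness:
  marginal utility is at most the price, with equality at positive loads. Hence a higher net
  marginal utility \<open>k\<^sub>i - \<lambda>\<close> strictly increases every positive load; as the total load is fixed and
  positive, the price is unique and monotone in \<open>k\<close>. Existence is the intermediate value theorem
  applied to the aggregate demand, with linear agents absorbing the residual supply.\<close>

text \<open>Changing the load by \<open>h\<close> changes the payoff by
  \<open>h * (d - b * h / 2)\<close>, where \<open>d\<close> is the net marginal utility at
  \<open>x\<close>. For small \<open>h\<close> the sign is that of \<open>h * d\<close>, which gives
  necessity; concavity makes the second term harmless, which gives sufficiency.\<close>

lemma is_arg_max_concave_quadratic_iff:
  fixes b k lam c x :: real
  assumes b: "0 \<le> b"
  shows "is_arg_max (\<lambda>y. - (1 / 2) * b * y\<^sup>2 + k * y + lam * (c - y)) (\<lambda>y. 0 \<le> y) x \<longleftrightarrow>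
    0 \<le> x \<and> k - lam \<le> b * x \<and> (0 < x \<longrightarrow> b * x = k - lam)"
    (is "is_arg_max ?g _ _ \<longleftrightarrow> _")
proof -
  define d where "d = k - lam - b * x"
  have diff: "?g (x + h) - ?g x = h * (d - b * h / 2)" for h
    by (simp add: d_def field_simps power2_eq_square)
  have "0 \<le> x \<and> d \<le> 0 \<and> (0 < x \<longrightarrow> d = 0)" if "is_arg_max ?g (\<lambda>y. 0 \<le> y) x"
  proof -
    have x0: "0 \<le> x"
      using that by (simp add: is_arg_max_def)
    have max: "?g y \<le> ?g x" if "0 \<le> y" for y
      using \<open>is_arg_max ?g (\<lambda>y. 0 \<le> y) x\<close> that unfolding is_arg_max_def by (meson not_less)
    have "d \<le> 0"
    proof (rule ccontr)
      assume "\<not> d \<le> 0"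
      \<comment> \<open>A step short enough that \<open>b * h < d\<close>; the \<open>+ 1\<close>
        also covers linear utilities, where \<open>b = 0\<close>.\<close>
      define h where "h = d / (b + 1)"
      have h: "0 < h" "b * h < d"
        using \<open>\<not> d \<le> 0\<close> b by (auto simp: h_def field_simps)
      then have "0 < h * (d - b * h / 2)"
        using mult_nonneg_nonneg[of b h] b by (intro mult_pos_pos) linarith+
      with diff[of h] max[of "x + h"] x0 h show False by simp
    qed
    moreover have "0 \<le> d" if "0 < x"
    proof (rule ccontr)
      assume "\<not> 0 \<le> d"
      \<comment> \<open>This time the step goes down, so it is capped by \<open>x\<close> to keep
        the load nonnegative.\<close>
      define h where "h = min x (- d / (b + 1))"
      have h: "0 < h" "h \<le> x" "h \<le> - d / (b + 1)"
        using \<open>\<not> 0 \<le> d\<close> b \<open>0 < x\<close> by (auto simp: h_def field_simps)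
      have "b * h + h \<le> - d"
        using h(3) b by (simp add: field_simps)
      then have "0 < (- h) * (d - b * (- h) / 2)"
        using mult_nonneg_nonneg[OF b, of h] h(1) by (intro mult_neg_neg) auto
      with diff[of "- h"] max[of "x - h"] h show False by simp
    qed
    ultimately show ?thesis using x0 by auto
  qed
  moreover have "is_arg_max ?g (\<lambda>y. 0 \<le> y) x"
    if kkt: "0 \<le> x" "d \<le> 0" "0 < x \<longrightarrow> d = 0"
  proof -
    have "?g y \<le> ?g x" if "0 \<le> y" for y
    proof -
      define h where "h = y - x"
      have "h * d \<le> 0"
        using kkt that by (cases "x = 0") (auto simp: h_def mult_nonneg_nonpos)
      moreover have "0 \<le> b * h\<^sup>2"
        using b by simp
      moreover have "h * (d - b * h / 2) = h * d - b * h\<^sup>2 / 2"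
        by (simp add: right_diff_distrib power2_eq_square)
      ultimately have "?g (x + h) - ?g x \<le> 0"
        unfolding diff by linarith
      then show ?thesis by (simp add: h_def)
    qed
    then show ?thesis using kkt by (auto simp: is_arg_max_def not_less)
  qed
  ultimately have "is_arg_max ?g (\<lambda>y. 0 \<le> y) x \<longleftrightarrow> 0 \<le> x \<and> d \<le> 0 \<and> (0 < x \<longrightarrow> d = 0)"
    by blast
  moreover have "d \<le> 0 \<longleftrightarrow> k - lam \<le> b * x" "d = 0 \<longleftrightarrow> b * x = k - lam"
    by (auto simp: d_def)
  ultimately show ?thesis by (simp only:)
qed

lemma mem_competitive_equilibria_iff:
  fixes a k b x :: "real ^ 'n"
  assumes "\<forall>i. 0 \<le> b $ i"
  shows "(lam, x) \<in> competitive_equilibria a (quad_utility k b) \<longleftrightarrow>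
    (\<forall>i. 0 \<le> x $ i \<and> k $ i - lam \<le> b $ i * x $ i \<and>
      (0 < x $ i \<longrightarrow> b $ i * x $ i = k $ i - lam)) \<and>
    (\<Sum>i\<in>UNIV. x $ i) = (\<Sum>i\<in>UNIV. a $ i)"
  unfolding competitive_equilibria_def quad_utility_def mem_Collect_eq case_prod_conv
    is_arg_max_concave_quadratic_iff[OF assms[rule_format]]
  by (rule refl)

text \<open>Comparing arbitrary equilibria serves two purposes: \<open>k = k'\<close> yields
  uniqueness of the price, the general case its monotonicity.\<close>

lemma price_mono:
  fixes a k k' b x x' :: "real ^ 'n"
  assumes b: "\<forall>i. 0 \<le> b $ i" and C: "0 < (\<Sum>i\<in>UNIV. a $ i)" and kk': "k \<le> k'"
    and eq: "(lam, x) \<in> competitive_equilibria a (quad_utility k b)"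
    and eq': "(lam', x') \<in> competitive_equilibria a (quad_utility k' b)"
  shows "lam \<le> lam'"
proof (rule ccontr)
  assume "\<not> lam \<le> lam'"
  note E = eq[unfolded mem_competitive_equilibria_iff[OF b]]
  note E' = eq'[unfolded mem_competitive_equilibria_iff[OF b]]
  have strict: "x $ i < x' $ i" if "0 < x $ i" for i
  proof -
    have "b $ i * x $ i = k $ i - lam" using E that by blast
    also have "\<dots> < k' $ i - lam'"
      using kk'[unfolded less_eq_vec_def, rule_format, of i] \<open>\<not> lam \<le> lam'\<close> by linarith
    also have "\<dots> \<le> b $ i * x' $ i" using E' by blast
    \<comment> \<open>If \<open>b $ i = 0\<close>, the chain reads \<open>0 < 0\<close>, so only
      strictly concave agents survive here.\<close>
    finally show ?thesis using b by (meson mult_less_cancel_left not_less)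
  qed
  have le: "x $ i \<le> x' $ i" for i
    using strict[of i] E E' by (meson not_less less_imp_le order_trans)
  have "\<exists>i. 0 < x $ i"
    using sum_nonpos[of UNIV "\<lambda>i. x $ i"] E C by (force simp: not_less)
  then obtain i where "0 < x $ i" ..
  then have "(\<Sum>i\<in>UNIV. x $ i) < (\<Sum>i\<in>UNIV. x' $ i)"
    using le strict by (intro sum_strict_mono_ex1) auto
  then show False using E E' by simp
qed

text \<open>No equilibrium price lies below the largest \<open>k $ i\<close> of a linear agent,
  whose demand would be unbounded there. The search starts at such a price \<open>L\<close>: excess
  demand at \<open>L\<close> is removed by raising the price, a shortfall is absorbed by a linear
  agent indifferent at \<open>L\<close>.\<close>

lemma exists_competitive_equilibrium:
  fixes a k b :: "real ^ 'n"
  assumes b: "\<forall>i. 0 \<le> b $ i" and C: "0 < (\<Sum>i\<in>UNIV. a $ i)"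
  shows "\<exists>lam x. (lam, x) \<in> competitive_equilibria a (quad_utility k b)"
proof -
  define C where "C = (\<Sum>i\<in>UNIV. a $ i)"
  \<comment> \<open>Demand at price \<open>l\<close>; since \<open>t / 0 = 0\<close>, linear agents demand nothing.\<close>
  define z where "z l i = max 0 ((k $ i - l) / b $ i)" for l i
  define D where "D l = (\<Sum>i\<in>UNIV. z l i)" for l
  have z_nonneg: "0 \<le> z l i" for l i by (simp add: z_def)
  have z_kkt: "k $ i - l \<le> b $ i * z l i \<and> (0 < z l i \<longrightarrow> b $ i * z l i = k $ i - l)"
    if "b $ i = 0 \<longrightarrow> k $ i \<le> l" for l i
  proof (cases "b $ i = 0")
    case False
    with b have "0 < b $ i" by (simp add: order_less_le)
    then show ?thesis by (auto simp: z_def max_def field_simps)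
  qed (use that in \<open>simp add: z_def\<close>)
  \<comment> \<open>Each denominator is constant in the price, so multiplying by its inverse is
    continuous even when it is zero.\<close>
  have cont: "continuous_on S D" for S
    unfolding D_def z_def divide_inverse by (intro continuous_intros)
  obtain L where L: "\<forall>i. b $ i = 0 \<longrightarrow> k $ i \<le> L"
    and D_L: "C \<le> D L \<or> (\<exists>i. b $ i = 0 \<and> k $ i = L)"
  proof (cases "\<exists>i. b $ i = 0")
    case True
    let ?K = "(\<lambda>i. k $ i) ` {i. b $ i = 0}"
    have "Max ?K \<in> ?K" using True by (intro Max_in) auto
    have "\<forall>i. b $ i = 0 \<longrightarrow> k $ i \<le> Max ?K" by simp
    moreover have "\<exists>i. b $ i = 0 \<and> k $ i = Max ?K"
      using \<open>Max ?K \<in> ?K\<close> by (metis (mono_tags) imageE mem_Collect_eq)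
    ultimately show thesis using that[of "Max ?K"] by blast
  next
    case False
    fix j :: 'n
    \<comment> \<open>Solves \<open>(k $ j - l) / b $ j = C\<close>: agent \<open>j\<close> alone
      then demands the whole supply.\<close>
    define l where "l = k $ j - C * b $ j"
    have "C \<le> z l j" using False by (simp add: z_def l_def)
    also have "z l j \<le> D l"
      unfolding D_def by (rule member_le_sum) (auto simp: z_nonneg)
    finally show thesis using False that[of l] by blast
  qed
  show ?thesis
  proof (cases "C \<le> D L")
    case True
    \<comment> \<open>At a price above every \<open>k $ i\<close> all demand vanishes, which gives
      the upper end for the intermediate value theorem.\<close>
    define U where "U = max L (Max (range (\<lambda>i. k $ i)))"
    have "k $ i \<le> U" for i
      unfolding U_def by (simp add: le_max_iff_disj)
    then have "z U i = 0" for i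
      using b by (simp add: z_def max_def divide_nonpos_nonneg order_antisym)
    then have "D U \<le> C" using C by (simp add: D_def C_def)
    then obtain l where l: "L \<le> l" "D l = C"
      using IVT2'[of D U C L] True cont by (auto simp: U_def)
    have "(l, \<chi> i. z l i) \<in> competitive_equilibria a (quad_utility k b)"
      unfolding mem_competitive_equilibria_iff[OF b]
    proof (intro conjI allI)
      fix i
      have "b $ i = 0 \<longrightarrow> k $ i \<le> l" using L l(1) by (meson order_trans)
      from z_kkt[OF this]
      show "k $ i - l \<le> b $ i * (\<chi> i. z l i) $ i"
        "0 < (\<chi> i. z l i) $ i \<longrightarrow> b $ i * (\<chi> i. z l i) $ i = k $ i - l"
        by simp_all
    qed (use z_nonneg l(2) in \<open>simp_all add: D_def C_def\<close>)
    then show ?thesis by blast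
  next
    case False
    then obtain j where j: "b $ j = 0" "k $ j = L" using D_L by blast
    \<comment> \<open>Agent \<open>j\<close> is linear with marginal utility exactly
      \<open>L\<close>, so every nonnegative load is optimal for it, in particular the residual
      \<open>C - D L\<close>.\<close>
    define x where "x = (\<chi> i. z L i + (if i = j then C - D L else 0))"
    have "(\<Sum>i\<in>UNIV. x $ i) = C"
      by (simp add: x_def sum.distrib D_def)
    moreover have "0 \<le> x $ i \<and> k $ i - L \<le> b $ i * x $ i \<and>
        (0 < x $ i \<longrightarrow> b $ i * x $ i = k $ i - L)" for i
      using z_kkt[of i L] z_nonneg[of L i] L j False by (auto simp: x_def)
    ultimately have "(L, x) \<in> competitive_equilibria a (quad_utility k b)"
      unfolding mem_competitive_equilibria_iff[OF b] C_def by blast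
    then show ?thesis by blast
  qed
qed

text \<open>Only the price is claimed: two linear agents indifferent at that price may split their
  joint load arbitrarily.\<close>

lemma equilibrium_price_unique:
  fixes a k b :: "real ^ 'n"
  assumes "\<forall>i. 0 \<le> b $ i" and "0 < (\<Sum>i\<in>UNIV. a $ i)"
  shows "\<exists>!lam. \<exists>x. (lam, x) \<in> competitive_equilibria a (quad_utility k b)"
proof -
  have "lam = lam'"
    if "(lam, x) \<in> competitive_equilibria a (quad_utility k b)"
      and "(lam', x') \<in> competitive_equilibria a (quad_utility k b)" for lam x lam' x'
    using price_mono[OF assms order_refl] that by (meson order_antisym)
  with exists_competitive_equilibrium[OF assms] show ?thesis by blast
qed

lemma equilibrium_price_equilibrium:
  fixes a k b :: "real ^ 'n"
  assumes "\<forall>i. 0 \<le> b $ i" and "0 < (\<Sum>i\<in>UNIV. a $ i)"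
  shows "\<exists>x. (equilibrium_price a k b, x) \<in> competitive_equilibria a (quad_utility k b)"
  unfolding equilibrium_price_def by (rule theI'[OF equilibrium_price_unique[OF assms]])

text \<open>With strictly concave utilities the price determines each load through
  \<open>b $ i * x $ i = max 0 (k $ i - lam)\<close>, so uniqueness of the price carries over to the
  pair.\<close>

lemma competitive_equilibrium_unique:
  fixes a k b :: "real ^ 'n"
  assumes b: "\<forall>i. 0 < b $ i" and C: "0 < (\<Sum>i\<in>UNIV. a $ i)"
  shows "\<exists>!p. p \<in> competitive_equilibria a (quad_utility k b)"
proof -
  have b0: "\<forall>i. 0 \<le> b $ i" using b by (simp add: less_imp_le)
  have "x = x'"
    if "(lam, x) \<in> competitive_equilibria a (quad_utility k b)"
      and "(lam, x') \<in> competitive_equilibria a (quad_utility k b)" for lam x x'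
  proof -
    have "x $ i = x' $ i" for i
    proof -
      have load: "b $ i * y $ i = max 0 (k $ i - lam)"
        if "(lam, y) \<in> competitive_equilibria a (quad_utility k b)" for y
      proof -
        have "0 \<le> y $ i" "k $ i - lam \<le> b $ i * y $ i" "0 < y $ i \<longrightarrow> b $ i * y $ i = k $ i - lam"
          using that[unfolded mem_competitive_equilibria_iff[OF b0]] by blast+
        moreover have "0 \<le> b $ i * y $ i" using b0 \<open>0 \<le> y $ i\<close> by simp
        ultimately show ?thesis by (cases "y $ i = 0") simp_all
      qed
      have "b $ i * x $ i = b $ i * x' $ i"
        using load[OF that(1)] load[OF that(2)] by simp
      moreover have "b $ i \<noteq> 0" using b by (metis less_irrefl)
      ultimately show ?thesis by simp
    qed
    then show ?thesis by (simp add: vec_eq_iff)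
  qed
  moreover obtain lam x where "(lam, x) \<in> competitive_equilibria a (quad_utility k b)"
    and "\<And>lam' x'. (lam', x') \<in> competitive_equilibria a (quad_utility k b) \<Longrightarrow> lam' = lam"
    using equilibrium_price_unique[OF b0 C, of k] by (elim ex1E exE) blast
  ultimately show ?thesis by (intro ex1I[of _ "(lam, x)"]) (assumption, metis surj_pair)
qed

lemma socially_admissible_b_pos:
  assumes "S \<in> S_star n C lam_dag" and "socially_admissible S k b"
  shows "0 < b $ i"
proof -
  obtain kmin kmax bmin bmax where S_eq: "S = (kmin, kmax, bmin, bmax)" by (cases S)
  have "0 < bmin" "bmin \<le> b $ i"
    using assms by (simp_all add: S_eq S_star_def socially_admissible_def)
  then show ?thesis by simp
qed

text \<open>Above \<open>lam_dag\<close>, total load is strictly below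
  \<open>n * kmax / bmin - n * lam_dag / bmax\<close>, which the last inequality of
  \<open>S_star\<close> bounds by the supply; the market could not clear.\<close>

lemma S_star_price_le:
  fixes a k b x :: "real ^ 'n"
  assumes C: "0 < (\<Sum>i\<in>UNIV. a $ i)" and lam_dag: "0 < lam_dag"
    and S: "S \<in> S_star CARD('n) (\<Sum>i\<in>UNIV. a $ i) lam_dag"
    and adm: "socially_admissible S k b"
    and eq: "(lam, x) \<in> competitive_equilibria a (quad_utility k b)"
  shows "lam \<le> lam_dag"
proof (rule ccontr)
  assume lam: "\<not> lam \<le> lam_dag"
  obtain kmin kmax bmin bmax where S_eq: "S = (kmin, kmax, bmin, bmax)" by (cases S)
  let ?n = "real CARD('n)"
  have pos: "0 < bmin" "0 < bmax"
    and bound: "?n * kmax / bmin \<le> (\<Sum>i\<in>UNIV. a $ i) + ?n * lam_dag / bmax"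
    using S by (auto simp: S_eq S_star_def)
  have adm': "k $ i \<le> kmax" "bmin \<le> b $ i" "b $ i \<le> bmax" for i
    using adm by (auto simp: S_eq socially_admissible_def)
  then have "bmin \<le> bmax" by (meson order_trans)
  have b0: "\<forall>i. 0 \<le> b $ i"
    using socially_admissible_b_pos[OF S adm] by (simp add: less_imp_le)
  note E = eq[unfolded mem_competitive_equilibria_iff[OF b0]]
  have pos_load: "x $ i \<le> (kmax - lam) / bmin" if "0 < x $ i" for i
  proof -
    have "bmin * x $ i \<le> b $ i * x $ i"
      using adm'(2) that by (simp add: mult_right_mono)
    also have "\<dots> \<le> kmax - lam" using E that adm'(1)[of i] by simp
    finally show ?thesis using pos by (simp add: field_simps)
  qed
  have "\<exists>j. 0 < x $ j"
    using sum_nonpos[of UNIV "\<lambda>i. x $ i"] E C by (force simp: not_less)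
  then obtain j where j: "0 < x $ j" ..
  \<comment> \<open>Agents with zero load obey the bound too, since the positive load of
    \<open>j\<close> shows its right-hand side to be positive.\<close>
  have "x $ i \<le> (kmax - lam) / bmin" for i
    using pos_load[of i] pos_load[OF j] j by linarith
  then have "(\<Sum>i\<in>UNIV. x $ i) \<le> ?n * ((kmax - lam) / bmin)"
    by (rule sum_bounded_above)
  also have "\<dots> = ?n * kmax / bmin - ?n * (lam / bmin)"
    by (simp add: diff_divide_distrib right_diff_distrib)
  \<comment> \<open>Passing from \<open>bmin\<close> to \<open>bmax\<close> needs a nonnegative
    price, ensured by \<open>lam > lam_dag > 0\<close>.\<close>
  also have "lam / bmax \<le> lam / bmin"
    using lam lam_dag pos \<open>bmin \<le> bmax\<close> by (intro divide_left_mono) auto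
  then have "?n * kmax / bmin - ?n * (lam / bmin) \<le> ?n * kmax / bmin - ?n * (lam / bmax)"
    by (intro diff_left_mono mult_left_mono) auto
  also have "lam_dag / bmax < lam / bmax"
    using lam pos by (simp add: divide_strict_right_mono)
  then have "?n * kmax / bmin - ?n * (lam / bmax) < ?n * kmax / bmin - ?n * (lam_dag / bmax)"
    by (intro diff_strict_left_mono mult_strict_left_mono) auto
  also have "\<dots> \<le> (\<Sum>i\<in>UNIV. a $ i)" using bound by simp
  finally show False using E by simp
qed

theorem theorem3:
  fixes a :: "real ^ 'n" and C lam_dag :: real
  assumes "C = (\<Sum>i\<in>UNIV. a $ i)"
    and "C > 0"
    and "lam_dag > 0"
  shows
    "(\<forall>k b :: real ^ 'n. (\<forall>i. 0 \<le> k $ i) \<and> (\<forall>i. 0 \<le> b $ i) \<longrightarrow>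
        (\<exists>x. (equilibrium_price a k b, x) \<in> competitive_equilibria a (quad_utility k b)) \<and>
        (\<exists>!lam. \<exists>x. (lam, x) \<in> competitive_equilibria a (quad_utility k b)) \<and>
        ((\<forall>i. 0 < b $ i) \<longrightarrow> (\<exists>!p. p \<in> competitive_equilibria a (quad_utility k b)))) \<and>
     (\<forall>S \<in> S_star CARD('n) C lam_dag. \<forall>k b :: real ^ 'n. socially_admissible S k b \<longrightarrow>
        (\<forall>lam x. (lam, x) \<in> competitive_equilibria a (quad_utility k b) \<longrightarrow> lam \<le> lam_dag)) \<and>
     (\<forall>S \<in> S_star CARD('n) C lam_dag. \<forall>k k' b :: real ^ 'n.
        socially_admissible S k b \<and> socially_admissible S k' b \<and> k \<le> k' \<longrightarrow>
        equilibrium_price a k b \<le> equilibrium_price a k' b)"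
proof (intro conjI)
  note C = \<open>C > 0\<close>[unfolded \<open>C = (\<Sum>i\<in>UNIV. a $ i)\<close>]
  show "\<forall>k b :: real ^ 'n. (\<forall>i. 0 \<le> k $ i) \<and> (\<forall>i. 0 \<le> b $ i) \<longrightarrow>
        (\<exists>x. (equilibrium_price a k b, x) \<in> competitive_equilibria a (quad_utility k b)) \<and>
        (\<exists>!lam. \<exists>x. (lam, x) \<in> competitive_equilibria a (quad_utility k b)) \<and>
        ((\<forall>i. 0 < b $ i) \<longrightarrow> (\<exists>!p. p \<in> competitive_equilibria a (quad_utility k b)))"
    by (intro allI impI conjI equilibrium_price_equilibrium equilibrium_price_unique
        competitive_equilibrium_unique C) (auto simp: C)
  show "\<forall>S \<in> S_star CARD('n) C lam_dag. \<forall>k b :: real ^ 'n. socially_admissible S k b \<longrightarrow>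
        (\<forall>lam x. (lam, x) \<in> competitive_equilibria a (quad_utility k b) \<longrightarrow> lam \<le> lam_dag)"
    by (intro ballI allI impI) (rule S_star_price_le[OF C \<open>lam_dag > 0\<close>, folded assms(1)])
  show "\<forall>S \<in> S_star CARD('n) C lam_dag. \<forall>k k' b :: real ^ 'n.
        socially_admissible S k b \<and> socially_admissible S k' b \<and> k \<le> k' \<longrightarrow>
        equilibrium_price a k b \<le> equilibrium_price a k' b"
  proof (intro ballI allI impI)
    fix S and k k' b :: "real ^ 'n"
    assume S: "S \<in> S_star CARD('n) C lam_dag"
      and adm: "socially_admissible S k b \<and> socially_admissible S k' b \<and> k \<le> k'"
    have b: "\<forall>i. 0 \<le> b $ i"
      using socially_admissible_b_pos[OF S] adm by (meson less_imp_le)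
    \<comment> \<open>Both prices are realised by actual equilibria, to which the comparison of
      arbitrary equilibria applies.\<close>
    show "equilibrium_price a k b \<le> equilibrium_price a k' b"
      using equilibrium_price_equilibrium[OF b C] price_mono[OF b C] adm by blast
  qed
qed

end
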